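(* Let $\alpha\in(0,1)\cup(1,\infty)$ and let $\rho,\sigma$ be density operators on a complex Hilbert space of finite dimension $n$, with eigenvalue vectors $\mathbf{p}$ and $\mathbf{q}$ (counted with multiplicity). Then $$\widetilde D_\alpha([\rho]\,\|\,[\sigma]):=\min_{U\text{ unitary}}D_\alpha(U\rho U^\dagger\|\sigma)=\frac{1}{\alpha-1}\ln\left(\sum_{i=1}^n (p_i^\uparrow)^\alpha (q_i^\uparrow)^{1-\alpha}\right).$$
   Context: For $\mathbf{x}\in\mathbb{R}^n$, $\mathbf{x}^\uparrow$ denotes the vector of its components arranged in non-descending order. The Petz-Rényi relative entropy is $D_\alpha(\rho\|\sigma):=\frac{1}{\alpha-1}\ln\left(\mathrm{Tr}\left[\rho^\alpha\sigma^{1-\alpha}\right]\right)\in(-\infty,+\infty]$, with the standard conventions: for $\alpha\in(0,1)$, $D_\alpha=+\infty$ when the trace is $0$; for $\alpha>1$, $D_\alpha(\rho\|\sigma)=+\infty$ if the support of $\rho$ is not contained in the support of $\sigma$, and otherwise $\sigma^{1-\alpha}$ is taken on the support of $\sigma$. Correspondingly, for $\alpha>1$, $p^\alpha q^{1-\alpha}$ is read as $0$ if $p=q=0$ and as $+\infty$ if $p>0=q$, and $\ln(+\infty)=+\infty$. *)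

theory Defs
  imports
    "Jordan_Normal_Form.Schur_Decomposition"
    "Jordan_Normal_Form.Char_Poly"
    "Jordan_Normal_Form.Matrix_Kernel"
    "HOL-Library.Extended_Real"
begin

text \<open>Operators on an \<open>n\<close>-dimensional complex Hilbert space are represented by complex
  \<open>n \<times> n\<close> matrices acting on \<open>carrier_vec n\<close> with the inner product \<open>u \<bullet>c v\<close>.\<close>

definition unitary_mat :: "nat \<Rightarrow> complex mat \<Rightarrow> bool" where
  "unitary_mat n U \<longleftrightarrow>
     U \<in> carrier_mat n n \<and> U * mat_adjoint U = 1\<^sub>m n \<and> mat_adjoint U * U = 1\<^sub>m n"

definition mat_trace :: "complex mat \<Rightarrow> complex" where
  "mat_trace A = (\<Sum>i<dim_row A. A $$ (i, i))"

definition density_operator :: "nat \<Rightarrow> complex mat \<Rightarrow> bool" where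
  "density_operator n \<rho> \<longleftrightarrow>
     \<rho> \<in> carrier_mat n n \<and> mat_adjoint \<rho> = \<rho> \<and>
     (\<forall>v \<in> carrier_vec n. 0 \<le> Re ((\<rho> *\<^sub>v v) \<bullet>c v)) \<and> mat_trace \<rho> = 1"

text \<open>Algebraic multiplicities are used; for Hermitian matrices they agree with the geometric ones.\<close>

definition eigenvalue_vector :: "complex mat \<Rightarrow> real list \<Rightarrow> bool" where
  "eigenvalue_vector A p \<longleftrightarrow> char_poly A = (\<Prod>x\<leftarrow>p. [:- complex_of_real x, 1:])"

definition mat_supp :: "complex mat \<Rightarrow> complex vec set" where
  "mat_supp A = {v \<in> carrier_vec (dim_row A). \<forall>w \<in> mat_kernel A. v \<bullet>c w = 0}"

text \<open>Real powers by functional calculus, for Hermitian \<open>A\<close>. As \<open>0 powr a = 0\<close> for every \<open>a\<close>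
  (negative \<open>a\<close> included), the power is taken on the support of \<open>A\<close> and is \<open>0\<close> on its kernel.
  The lemma \<open>mat_powr_eqI\<close> shows that the choice of the spectral decomposition is immaterial.\<close>

definition mat_powr :: "complex mat \<Rightarrow> real \<Rightarrow> complex mat" where
  "mat_powr A a = (THE B. \<exists>U (d :: nat \<Rightarrow> real). unitary_mat (dim_row A) U \<and>
     A = U * mat_diag (dim_row A) (\<lambda>i. complex_of_real (d i)) * mat_adjoint U \<and>
     B = U * mat_diag (dim_row A) (\<lambda>i. complex_of_real (d i powr a)) * mat_adjoint U)"

definition petz_renyi :: "real \<Rightarrow> complex mat \<Rightarrow> complex mat \<Rightarrow> ereal" where
  "petz_renyi \<alpha> \<rho> \<sigma> =
     (let Q = mat_trace (mat_powr \<rho> \<alpha> * mat_powr \<sigma> (1 - \<alpha>)) in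
      if (\<alpha> < 1 \<and> Q = 0) \<or> (\<alpha> > 1 \<and> \<not> mat_supp \<rho> \<subseteq> mat_supp \<sigma>) then \<infinity>
      else ereal (1 / (\<alpha> - 1) * ln (Re Q)))"

text \<open>Stated as an infimum, which exists for every argument; that it is attained, i.e. is a minimum,
  is for a theorem to assert.\<close>

definition petz_renyi_min :: "real \<Rightarrow> complex mat \<Rightarrow> complex mat \<Rightarrow> ereal" where
  "petz_renyi_min \<alpha> \<rho> \<sigma> =
     (INF U \<in> {U. unitary_mat (dim_row \<rho>) U}. petz_renyi \<alpha> (U * \<rho> * mat_adjoint U) \<sigma>)"

definition renyi_term :: "real \<Rightarrow> real \<Rightarrow> real \<Rightarrow> ereal" where
  "renyi_term \<alpha> x y =
     (if \<alpha> > 1 \<and> y = 0 then (if x = 0 then 0 else \<infinity>)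
      else ereal (x powr \<alpha> * y powr (1 - \<alpha>)))"

text \<open>On the reals \<open>ln 0 = 0\<close>, so the logarithm on the extended half-line \<open>[0, \<infinity>]\<close> is written out.
  The value \<open>- \<infinity>\<close> at \<open>0\<close> gives \<open>1 / (\<alpha> - 1) * ln 0 = + \<infinity>\<close> for \<open>\<alpha> < 1\<close>.\<close>

definition ln_ereal :: "ereal \<Rightarrow> ereal" where
  "ln_ereal x =
     (if x \<le> 0 then - \<infinity> else if x = \<infinity> then \<infinity> else ereal (ln (real_of_ereal x)))"

lemma mat_adjoint_carrier [simp]:
  "A \<in> carrier_mat n m \<Longrightarrow> mat_adjoint A \<in> carrier_mat m n"
  unfolding mat_adjoint_def mat_of_rows_def by auto

lemma mat_diag_intertwine:
  fixes W :: "complex mat" and d e :: "nat \<Rightarrow> real"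
  assumes W: "W \<in> carrier_mat n n"
    and eq: "W * mat_diag n (\<lambda>i. complex_of_real (d i)) = mat_diag n (\<lambda>i. complex_of_real (e i)) * W"
  shows "W * mat_diag n (\<lambda>i. complex_of_real (f (d i))) =
         mat_diag n (\<lambda>i. complex_of_real (f (e i))) * W"
proof (rule eq_matI)
  fix i j
  assume "i < dim_row (mat_diag n (\<lambda>i. complex_of_real (f (e i))) * W)"
    and "j < dim_col (mat_diag n (\<lambda>i. complex_of_real (f (e i))) * W)"
  then have ij: "i < n" "j < n" using W by (auto simp: mat_diag_def)
  have "(W * mat_diag n (\<lambda>i. complex_of_real (d i))) $$ (i, j) =
        (mat_diag n (\<lambda>i. complex_of_real (e i)) * W) $$ (i, j)" using eq by simp
  then have "W $$ (i, j) * complex_of_real (d j) = complex_of_real (e i) * W $$ (i, j)"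
    using ij W by (simp add: mat_diag_mult_left[OF W] mat_diag_mult_right[OF W])
  then have "W $$ (i, j) = 0 \<or> d j = e i" by (auto simp: mult.commute)
  then show "(W * mat_diag n (\<lambda>i. complex_of_real (f (d i)))) $$ (i, j) =
        (mat_diag n (\<lambda>i. complex_of_real (f (e i))) * W) $$ (i, j)"
    using ij W by (auto simp add: mat_diag_mult_left[OF W] mat_diag_mult_right[OF W])
qed (use W in \<open>auto simp: mat_diag_def\<close>)

lemma mat_powr_eqI:
  assumes U: "unitary_mat (dim_row A) U"
    and A: "A = U * mat_diag (dim_row A) (\<lambda>i. complex_of_real (d i)) * mat_adjoint U"
  shows "mat_powr A a =
    U * mat_diag (dim_row A) (\<lambda>i. complex_of_real (d i powr a)) * mat_adjoint U"
  unfolding mat_powr_def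
proof (rule the_equality)
  show "\<exists>V e. unitary_mat (dim_row A) V \<and>
      A = V * mat_diag (dim_row A) (\<lambda>i. complex_of_real (e i)) * mat_adjoint V \<and>
      U * mat_diag (dim_row A) (\<lambda>i. complex_of_real (d i powr a)) * mat_adjoint U =
      V * mat_diag (dim_row A) (\<lambda>i. complex_of_real (e i powr a)) * mat_adjoint V"
    using U A by blast
next
  fix B
  define n where "n = dim_row A"
  define D where "D = (\<lambda>h :: nat \<Rightarrow> real. mat_diag n (\<lambda>i. complex_of_real (h i)))"
  have D: "D h \<in> carrier_mat n n" for h by (simp add: D_def)
  assume "\<exists>V e. unitary_mat (dim_row A) V \<and>
      A = V * mat_diag (dim_row A) (\<lambda>i. complex_of_real (e i)) * mat_adjoint V \<and>
      B = V * mat_diag (dim_row A) (\<lambda>i. complex_of_real (e i powr a)) * mat_adjoint V"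
  then obtain V e where V: "unitary_mat n V" and AV: "A = V * D e * mat_adjoint V"
    and B: "B = V * D (\<lambda>i. e i powr a) * mat_adjoint V"
    unfolding n_def D_def by blast
  let ?U = "mat_adjoint U" and ?V = "mat_adjoint V"
  have cU: "U \<in> carrier_mat n n" "?U \<in> carrier_mat n n" and uU: "U * ?U = 1\<^sub>m n" "?U * U = 1\<^sub>m n"
    using U unfolding unitary_mat_def n_def by auto
  have cV: "V \<in> carrier_mat n n" "?V \<in> carrier_mat n n" and uV: "V * ?V = 1\<^sub>m n" "?V * V = 1\<^sub>m n"
    using V unfolding unitary_mat_def by auto
  note [simp] = cU cV uU uV D
  have cl [simp]: "X * Y \<in> carrier_mat n n"
    if "X \<in> carrier_mat n n" "Y \<in> carrier_mat n n" for X Y :: "complex mat"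
    using that by (rule mult_carrier_mat)
  have as: "X * Y * Z = X * (Y * Z)"
    if "X \<in> carrier_mat n n" "Y \<in> carrier_mat n n" "Z \<in> carrier_mat n n" for X Y Z :: "complex mat"
    using that by (rule assoc_mult_mat)
  have one: "1\<^sub>m n * X = X" "X * 1\<^sub>m n = X" if "X \<in> carrier_mat n n" for X :: "complex mat"
    using that by (rule left_mult_one_mat right_mult_one_mat)+
  have canc: "V * (?V * X) = X" "?V * (V * X) = X" "?U * (U * X) = X"
    if "X \<in> carrier_mat n n" for X
    using that as[of V ?V X] as[of ?V V X] as[of ?U U X] by (simp_all only: cU cV uU uV one)
  note rw = as canc one uU uV cU cV D cl
  have "U * D d * ?U = V * D e * ?V" using A AV unfolding n_def D_def by simp
  then have "?V * (U * D d * ?U) * U = ?V * (V * D e * ?V) * U" by simp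
  then have "?V * U * D d = D e * (?V * U)" by (simp only: rw)
  then have "?V * U * D (\<lambda>i. d i powr a) = D (\<lambda>i. e i powr a) * (?V * U)"
    unfolding D_def by (rule mat_diag_intertwine[OF cl, OF cV(2) cU(1)])
  then have "V * (?V * U * D (\<lambda>i. d i powr a)) * ?U = V * (D (\<lambda>i. e i powr a) * (?V * U)) * ?U"
    by simp
  then have "U * D (\<lambda>i. d i powr a) * ?U = V * D (\<lambda>i. e i powr a) * ?V"
    by (simp only: rw)
  then show "B = U * mat_diag (dim_row A) (\<lambda>i. complex_of_real (d i powr a)) * mat_adjoint U"
    using B unfolding D_def n_def by simp
qed

end

(* Diagonalise \<rho> = R D(x) R* and \<sigma> = V D(y) V* with x and y sorted in ascending order. The trace
   for the unitary U is then the sum of |W_ji|^2 x_i^\<alpha> y_j^(1-\<alpha>) with W = V* U R, and the weights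
   |W_ji|^2 form a doubly stochastic matrix. The rearrangement inequality for such matrices bounds
   this sum by the diagonal one, from above for \<alpha> < 1 and from below for \<alpha> > 1, and U = V R*
   attains the bound. For \<alpha> > 1 the vanishing eigenvalues of \<sigma> need care: inclusion of supports
   means that W_ji = 0 whenever x_i > 0 and y_j = 0. *)
theory Submission
  imports Defs
begin

subsection \<open>Spectral decomposition of Hermitian matrices\<close>

lemma index_mat_adjoint [simp]:
  "i < dim_col A \<Longrightarrow> j < dim_row A \<Longrightarrow> mat_adjoint A $$ (i, j) = conjugate (A $$ (j, i))"
  by (simp add: mat_adjoint_def mat_of_rows_def)

lemma dim_mat_adjoint [simp]:
  "dim_row (mat_adjoint A) = dim_col A" "dim_col (mat_adjoint A) = dim_row A"
  by (simp_all add: mat_adjoint_def)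

lemma mat_adjoint_mult:
  assumes "A \<in> carrier_mat n m" "B \<in> carrier_mat m k"
  shows "mat_adjoint (A * B) = mat_adjoint B * mat_adjoint (A :: complex mat)"
proof (rule eq_matI)
  fix i j assume "i < dim_row (mat_adjoint B * mat_adjoint A)" "j < dim_col (mat_adjoint B * mat_adjoint A)"
  then show "mat_adjoint (A * B) $$ (i, j) = (mat_adjoint B * mat_adjoint A) $$ (i, j)"
    using assms by (auto simp: scalar_prod_def sum_conjugate conjugate_dist_mul mult.commute)
qed (use assms in auto)

lemma mat_adjoint_mat_adjoint [simp]: "mat_adjoint (mat_adjoint A) = (A :: complex mat)"
  by (rule eq_matI) auto

text \<open>A left inverse of a square matrix is also a right inverse, so one of the two unitarity
  equations suffices.\<close>

lemma unitary_matI: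
  assumes "U \<in> carrier_mat n n" "mat_adjoint U * U = 1\<^sub>m n"
  shows "unitary_mat n U"
  using assms mat_mult_left_right_inverse[OF mat_adjoint_carrier[OF assms(1)] assms(1) assms(2)]
  by (simp add: unitary_mat_def)

lemma unitary_mat_mult:
  assumes "unitary_mat n U" "unitary_mat n V"
  shows "unitary_mat n (U * V)"
proof (rule unitary_matI)
  from assms have U: "U \<in> carrier_mat n n" "mat_adjoint U * U = 1\<^sub>m n"
    and V: "V \<in> carrier_mat n n" "mat_adjoint V * V = 1\<^sub>m n"
    by (auto simp: unitary_mat_def)
  note aU = mat_adjoint_carrier[OF U(1)] and aV = mat_adjoint_carrier[OF V(1)]
  show "U * V \<in> carrier_mat n n" using U V by simp
  have "mat_adjoint (U * V) * (U * V) = mat_adjoint V * (mat_adjoint U * U * V)"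
    using U(1) V(1) aU aV by (simp add: mat_adjoint_mult assoc_mult_mat[of _ n n _ n _ n])
  then show "mat_adjoint (U * V) * (U * V) = 1\<^sub>m n" using U V by simp
qed

lemma unitary_mat_adjoint: "unitary_mat n U \<Longrightarrow> unitary_mat n (mat_adjoint U)"
  by (auto simp: unitary_mat_def)

text \<open>The vector is completed to a basis, orthogonalised by Gram-Schmidt, which keeps the
  first vector, and normalised. The scalar \<open>c\<close> absorbs the normalisation.\<close>

lemma unitary_mat_with_first_col:
  assumes v: "v \<in> carrier_vec n" "v \<noteq> 0\<^sub>v n"
  obtains W c where "unitary_mat n W" "col W 0 = c \<cdot>\<^sub>v v" "n \<noteq> 0"
proof -
  have "v = 0\<^sub>v n" if "n = 0" using v(1) that by (intro eq_vecI) simp_all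
  with v(2) have n: "n \<noteq> 0" by blast
  interpret cof_vec_space n "TYPE(complex)" .
  define b where "b = basis_completion v"
  define ws where "ws = gram_schmidt n b"
  from basis_completion[OF v, folded b_def]
  have b: "distinct b" "\<not> lin_dep (set b)" "set b \<subseteq> carrier_vec n" "hd b = v" "length b = n"
    by auto
  obtain vs where bv: "b = v # vs" using b n by (cases b) auto
  from gram_schmidt_result[OF b(3,1,2) refl, folded ws_def]
  have ws: "set ws \<subseteq> carrier_vec n" "corthogonal ws" "length ws = n" using b by auto
  have "hd ws = v" using gram_schmidt_hd[OF v(1), of vs, folded bv] unfolding ws_def .
  then have ws0: "ws ! 0 = v" using n ws by (cases ws) auto
  have wsi: "ws ! i \<in> carrier_vec n" if "i < n" for i using ws that by auto
  \<comment> \<open>Gram-Schmidt yields orthogonal vectors of arbitrary length; \<open>c i\<close>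
    is the reciprocal norm of \<open>ws ! i\<close>.\<close>
  define c where "c i = complex_of_real (1 / sqrt (Re (ws ! i \<bullet>c ws ! i)))" for i
  define W where "W = mat n n (\<lambda>(k, i). c i * ws ! i $ k)"
  have colW: "col W i = c i \<cdot>\<^sub>v ws ! i" if "i < n" for i
    using that wsi[OF that] by (intro eq_vecI) (auto simp: W_def)
  have "mat_adjoint W * W = 1\<^sub>m n"
  proof (rule eq_matI)
    fix i j assume "i < dim_row (1\<^sub>m n)" "j < dim_col (1\<^sub>m n)"
    then have ij: "i < n" "j < n" by auto
    have eq: "(mat_adjoint W * W) $$ (i, j) = cnj (c i) * c j * (ws ! j \<bullet>c ws ! i)"
      using ij wsi[of i] wsi[of j]
      by (auto simp: scalar_prod_def W_def sum_distrib_left conjugate_complex_def ac_simps intro!: sum.cong)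
    show "(mat_adjoint W * W) $$ (i, j) = 1\<^sub>m n $$ (i, j)"
    proof (cases "i = j")
      case True
      have ge: "ws ! i \<bullet>c ws ! i \<ge> 0" by (rule conjugate_square_ge_0_vec)
      have "ws ! i \<bullet>c ws ! i \<noteq> 0" using corthogonalD[OF ws(2), of i i] ij ws by auto
      with ge have pos: "Re (ws ! i \<bullet>c ws ! i) > 0" "Im (ws ! i \<bullet>c ws ! i) = 0"
        by (auto simp: less_eq_complex_def complex_eq_iff less_le)
      then obtain r where r: "ws ! i \<bullet>c ws ! i = complex_of_real r" "r > 0"
        by (metis complex_is_Real_iff Reals_cases Re_complex_of_real)
      show ?thesis unfolding eq using True ij r
        by (simp add: c_def flip: of_real_mult)
    next
      case False
      then have "ws ! j \<bullet>c ws ! i = 0" using corthogonalD[OF ws(2), of j i] ij ws by auto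
      then show ?thesis using ij False by (simp add: eq)
    qed
  qed (auto simp: W_def)
  then have "unitary_mat n W" by (intro unitary_matI) (auto simp: W_def)
  moreover have "col W 0 = c 0 \<cdot>\<^sub>v v" using colW[of 0] n ws0 by simp
  ultimately show ?thesis using that n by blast
qed

lemma char_poly_unitary_conj:
  assumes A: "A \<in> carrier_mat n n" and U: "unitary_mat n U"
  shows "char_poly (mat_adjoint U * A * U) = char_poly A"
proof (rule char_poly_similar)
  have "similar_mat_wit (mat_adjoint U * A * U) A (mat_adjoint U) U"
    using assms by (intro similar_mat_witI[of _ _ n]) (auto simp: unitary_mat_def)
  then show "similar_mat (mat_adjoint U * A * U) A" unfolding similar_mat_def by blast
qed

lemma mult_block_diag_mat:
  assumes "A \<in> carrier_mat k k" "A' \<in> carrier_mat k k" "B \<in> carrier_mat m m" "B' \<in> carrier_mat m m"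
  shows "four_block_mat A (0\<^sub>m k m) (0\<^sub>m m k) B * four_block_mat A' (0\<^sub>m k m) (0\<^sub>m m k) B' =
    four_block_mat (A * A') (0\<^sub>m k m) (0\<^sub>m m k) (B * (B' :: complex mat))"
  using assms by (subst mult_four_block_mat[of _ k k _ m _ m _ _ k _ m]) auto

text \<open>Deflation, by induction on the eigenvalue list: a unitary whose first column is an
  eigenvector for the head splits off a 1-by-1 block, and the remaining Hermitian block has the tail
  as its eigenvalues. The order of \<open>es\<close> is arbitrary and is kept on the diagonal, so
  sorted lists may be used later.\<close>

lemma hermitian_spectral_decomposition:
  assumes "A \<in> carrier_mat n n" "mat_adjoint A = A" "eigenvalue_vector A es"
  obtains U where "unitary_mat n U"
    "A = U * mat_diag n (\<lambda>i. complex_of_real (es ! i)) * mat_adjoint U"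
  using assms
proof (induction es arbitrary: n A thesis)
  case Nil
  then have "n = 0" using degree_monic_char_poly[of A n] by (auto simp: eigenvalue_vector_def)
  with Nil show ?case
    by (intro Nil(1)[of "1\<^sub>m 0"] unitary_matI eq_matI) auto
next
  case (Cons e es n A)
  let ?e = "complex_of_real e"
  note A = Cons.prems(2)
  have cp: "char_poly A = [:- ?e, 1:] * (\<Prod>x\<leftarrow>es. [:- complex_of_real x, 1:])"
    using Cons.prems(4) by (simp add: eigenvalue_vector_def)
  have "eigenvalue A ?e" unfolding eigenvalue_root_char_poly[OF A] cp by simp
  then obtain v where v: "v \<in> carrier_vec n" "v \<noteq> 0\<^sub>v n" "A *\<^sub>v v = ?e \<cdot>\<^sub>v v"
    using A unfolding eigenvalue_def eigenvector_def by auto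
  from unitary_mat_with_first_col[OF v(1,2)] obtain W c
    where W: "unitary_mat n W" and W0: "col W 0 = c \<cdot>\<^sub>v v" and n: "n \<noteq> 0" .
  then obtain m where m: "n = Suc m" by (cases n) auto
  have cW: "W \<in> carrier_mat n n" and uW: "mat_adjoint W * W = 1\<^sub>m n" "W * mat_adjoint W = 1\<^sub>m n"
    using W by (auto simp: unitary_mat_def)
  note aW = mat_adjoint_carrier[OF cW]
  define B where "B = mat_adjoint W * A * W"
  have B: "B \<in> carrier_mat n n" using A cW aW by (simp add: B_def mult_carrier_mat[of _ n n _ n])
  have Bh: "mat_adjoint B = B"
    using A cW aW Cons.prems(3)
    by (simp add: B_def mat_adjoint_mult[of _ n n _ n] assoc_mult_mat[of _ n n _ n _ n] mult_carrier_mat[of _ n n _ n])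
  have "col B 0 = (mat_adjoint W * A) *\<^sub>v col W 0"
    unfolding B_def using n by (intro col_mult2[OF mult_carrier_mat[OF aW A] cW]) simp
  also have "\<dots> = mat_adjoint W *\<^sub>v (A *\<^sub>v col W 0)"
    using col_dim[of W 0] cW by (intro assoc_mult_mat_vec[OF aW A]) simp
  also have "A *\<^sub>v col W 0 = ?e \<cdot>\<^sub>v col W 0"
    unfolding W0 using A v by (simp add: mult_mat_vec[of _ n n] smult_smult_assoc mult.commute)
  also have "mat_adjoint W *\<^sub>v (?e \<cdot>\<^sub>v col W 0) = ?e \<cdot>\<^sub>v col (mat_adjoint W * W) 0"
    using cW aW n by (subst mult_mat_vec[of _ n n]) (auto simp: col_mult2[of _ n n _ n])
  finally have col0: "col B 0 = ?e \<cdot>\<^sub>v unit_vec n 0" using uW n by simp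
  have B0: "B $$ (i, 0) = (if i = 0 then ?e else 0)" if "i < n" for i
  proof -
    have "B $$ (i, 0) = col B 0 $ i" using B that by simp
    then show ?thesis using that n unfolding col0 by (auto simp: unit_vec_def)
  qed
  \<comment> \<open>Hermitian symmetry carries the zeros of the first column over to the first row,
    so \<open>B\<close> is block diagonal and not merely block triangular.\<close>
  have B0': "B $$ (0, i) = (if i = 0 then ?e else 0)" if "i < n" for i
    using arg_cong[OF Bh, of "\<lambda>X. X $$ (0, i)"] that n B B0[OF that]
    by (auto simp: conjugate_complex_def split: if_splits)
  define C where "C = mat m m (\<lambda>(i, j). B $$ (Suc i, Suc j))"
  have C: "C \<in> carrier_mat m m" by (simp add: C_def)
  have Bblock: "B = four_block_mat (mat 1 1 (\<lambda>_. ?e)) (0\<^sub>m 1 m) (0\<^sub>m m 1) C"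
    using B m B0 B0' by (intro eq_matI) (auto simp: C_def)
  have Ch: "mat_adjoint C = C"
  proof (rule eq_matI)
    fix i j assume "i < dim_row C" "j < dim_col C"
    then show "mat_adjoint C $$ (i, j) = C $$ (i, j)"
      using arg_cong[OF Bh, of "\<lambda>X. X $$ (Suc i, Suc j)"] B m by (auto simp: C_def)
  qed (auto simp: C_def)
  have "char_poly B = char_poly (mat 1 1 (\<lambda>_. ?e)) * char_poly C"
    unfolding Bblock by (rule char_poly_four_block_zeros_col) (use C in auto)
  also have "char_poly (mat 1 1 (\<lambda>_. ?e)) = [:- ?e, 1:]"
    by (simp add: char_poly_defs det_def sign_def)
  finally have "[:- ?e, 1:] * char_poly C = [:- ?e, 1:] * (\<Prod>x\<leftarrow>es. [:- complex_of_real x, 1:])"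
    using cp char_poly_unitary_conj[OF A W] by (simp add: B_def)
  \<comment> \<open>The nonzero linear factor of the split-off eigenvalue cancels.\<close>
  then have "eigenvalue_vector C es"
    unfolding eigenvalue_vector_def
    by (metis mult_cancel_left pCons_eq_0_iff zero_neq_one)
  from Cons.IH[OF _ C Ch this] obtain V where V: "unitary_mat m V"
    and CV: "C = V * mat_diag m (\<lambda>i. complex_of_real (es ! i)) * mat_adjoint V" .
  have cV: "V \<in> carrier_mat m m" and uV: "mat_adjoint V * V = 1\<^sub>m m"
    using V by (auto simp: unitary_mat_def)
  note aV = mat_adjoint_carrier[OF cV]
  \<comment> \<open>The diagonalising unitary of the block \<open>C\<close>, extended by the
    identity on the first coordinate.\<close>
  define V' where "V' = four_block_mat (1\<^sub>m 1) (0\<^sub>m 1 m) (0\<^sub>m m 1) V"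
  have cV': "V' \<in> carrier_mat n n" using cV m four_block_carrier_mat[of "1\<^sub>m 1" 1 1 V m m] by (simp add: V'_def)
  note aV' = mat_adjoint_carrier[OF cV']
  have adjV': "mat_adjoint V' = four_block_mat (1\<^sub>m 1) (0\<^sub>m 1 m) (0\<^sub>m m 1) (mat_adjoint V)"
    using cV by (intro eq_matI) (auto simp: V'_def conjugate_complex_def)
  have uV': "unitary_mat n V'"
  proof (rule unitary_matI[OF cV'])
    show "mat_adjoint V' * V' = 1\<^sub>m n"
      unfolding adjV' unfolding V'_def
      using cV aV uV m by (simp add: mult_block_diag_mat)
  qed
  define D where "D = mat_diag n (\<lambda>i. complex_of_real ((e # es) ! i))"
  have D: "D \<in> carrier_mat n n" by (simp add: D_def)
  have Dblock: "D = four_block_mat (mat 1 1 (\<lambda>_. ?e)) (0\<^sub>m 1 m) (0\<^sub>m m 1)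
      (mat_diag m (\<lambda>i. complex_of_real (es ! i)))"
    using m by (intro eq_matI) (auto simp: D_def mat_diag_def nth_Cons')
  have BV: "B = V' * D * mat_adjoint V'"
    unfolding adjV' Dblock unfolding V'_def Bblock CV
    using cV aV
    by (simp add: mult_block_diag_mat[of _ "Suc 0" _ _ m] mult_carrier_mat[of _ m m _ m])
  have "A = W * B * mat_adjoint W"
  proof -
    have "W * B * mat_adjoint W = (W * mat_adjoint W) * A * (W * mat_adjoint W)"
      using A cW aW by (simp add: B_def assoc_mult_mat[of _ n n _ n _ n] mult_carrier_mat[of _ n n _ n])
    then show ?thesis using A uW by simp
  qed
  also have "\<dots> = (W * V') * D * mat_adjoint (W * V')"
    using cW aW cV' aV' D by (simp add: BV mat_adjoint_mult[of _ n n _ n] assoc_mult_mat[of _ n n _ n _ n] mult_carrier_mat[of _ n n _ n])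
  finally show ?case
    using unitary_mat_mult[OF W uV'] Cons.prems(1) unfolding D_def by blast
qed

subsection \<open>Rearrangement for doubly stochastic weights\<close>

text \<open>Abel summation as an induction: passing from \<open>a (Suc n)\<close> down to
  \<open>a n\<close> can only raise the product with a nonpositive partial sum. The total sum of
  \<open>d\<close> may have either sign; in the application it is 0.\<close>

lemma abel_sum_ge:
  fixes a d :: "nat \<Rightarrow> real"
  assumes "\<And>i j. i \<le> j \<Longrightarrow> j \<le> n \<Longrightarrow> a i \<le> a j"
    and "\<And>k. k \<le> n \<Longrightarrow> sum d {..<k} \<le> 0"
  shows "a n * sum d {..<Suc n} \<le> (\<Sum>i<Suc n. a i * d i)"
  using assms
proof (induction n)
  case 0
  then show ?case by simp
next
  case (Suc n)
  have "a (Suc n) * sum d {..<Suc n} \<le> a n * sum d {..<Suc n}"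
    using Suc.prems(1)[of n "Suc n"] Suc.prems(2)[of "Suc n"] by (intro mult_right_mono_neg) auto
  also have "\<dots> \<le> (\<Sum>i<Suc n. a i * d i)" using Suc.prems by (intro Suc.IH) auto
  finally show ?case by (simp add: algebra_simps)
qed

text \<open>Averaging the ascending \<open>b\<close> by \<open>P\<close> does not lower the sum of
  its first \<open>k\<close> entries, and keeps the total. Pairing with the ascending
  \<open>a\<close> turns these partial-sum inequalities into the claim.\<close>

lemma doubly_stochastic_rearrangement:
  fixes a b :: "nat \<Rightarrow> real" and P :: "nat \<Rightarrow> nat \<Rightarrow> real"
  assumes nonneg: "\<And>i j. i < n \<Longrightarrow> j < n \<Longrightarrow> 0 \<le> P i j"
    and row: "\<And>i. i < n \<Longrightarrow> (\<Sum>j<n. P i j) = 1"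
    and col: "\<And>j. j < n \<Longrightarrow> (\<Sum>i<n. P i j) = 1"
    and a: "\<And>i j. i \<le> j \<Longrightarrow> j < n \<Longrightarrow> a i \<le> a j"
    and b: "\<And>i j. i \<le> j \<Longrightarrow> j < n \<Longrightarrow> b i \<le> b j"
  shows "(\<Sum>i<n. \<Sum>j<n. P i j * a i * b j) \<le> (\<Sum>i<n. a i * b i)"
proof -
  \<comment> \<open>Abel summation against \<open>a\<close>, for the difference \<open>d\<close> between \<open>b\<close> and its average under \<open>P\<close>.\<close>
  define d where "d i = b i - (\<Sum>j<n. P i j * b j)" for i
  have partial: "sum d {..<k} \<le> 0" if k: "k \<le> n" for k
  proof -
    \<comment> \<open>\<open>s\<close> holds the column masses of the first \<open>k\<close> rows:
      weights in [0, 1] of total \<open>k\<close>. Among such weights the indicator of the first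
      \<open>k\<close> indices gives the least weighted sum of \<open>b\<close>, and
      \<open>t\<close> is the deviation from it.\<close>
    define s where "s j = (\<Sum>i<k. P i j)" for j
    define t where "t j = s j - (if j < k then 1 else 0)" for j
    have s0: "0 \<le> s j" if "j < n" for j
      unfolding s_def using that k nonneg by (intro sum_nonneg) auto
    have s1: "s j \<le> 1" if "j < n" for j
      unfolding s_def col[OF that, symmetric] using that k nonneg by (intro sum_mono2) auto
    have ind: "(\<Sum>j<n. if j < k then f j else 0) = (\<Sum>j<k. f j)" for f :: "nat \<Rightarrow> real"
      using k by (intro sum.mono_neutral_cong_right) auto
    have "(\<Sum>j<n. s j) = (\<Sum>i<k. \<Sum>j<n. P i j)" unfolding s_def by (rule sum.swap)
    also have "\<dots> = k" using row k by simp
    finally have t: "(\<Sum>j<n. t j) = 0" by (simp add: t_def sum_subtractf ind)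
    \<comment> \<open>The pivot \<open>b (k - 1)\<close> separates the signs: \<open>t\<close> is
      nonpositive below index \<open>k\<close> and nonnegative from there on. As \<open>t\<close>
      sums to 0, the left side vanishes. For \<open>k = 0\<close> the pivot is \<open>b 0\<close>,
      and only the second case occurs.\<close>
    have "(\<Sum>j<n. b (k - 1) * t j) \<le> (\<Sum>j<n. b j * t j)"
    proof (rule sum_mono)
      fix j assume "j \<in> {..<n}"
      then have j: "j < n" by simp
      show "b (k - 1) * t j \<le> b j * t j"
      proof (cases "j < k")
        case True
        then show ?thesis
          using b[of j "k - 1"] s1[OF j] j k by (intro mult_right_mono_neg) (auto simp: t_def)
      next
        case False
        then show ?thesis
          using b[of "k - 1" j] s0[OF j] j by (intro mult_right_mono) (auto simp: t_def)
      qed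
    qed
    then have "0 \<le> (\<Sum>j<n. b j * t j)" using t by (simp flip: sum_distrib_left)
    also have "\<dots> = (\<Sum>j<n. b j * s j) - (\<Sum>j<n. if j < k then b j else 0)"
      unfolding sum_subtractf[symmetric] by (rule sum.cong) (auto simp: t_def algebra_simps)
    also have "(\<Sum>j<n. b j * s j) = (\<Sum>i<k. \<Sum>j<n. P i j * b j)"
      unfolding s_def sum_distrib_left by (subst sum.swap) (simp add: mult.commute)
    finally show ?thesis unfolding ind d_def sum_subtractf by simp
  qed
  have "0 \<le> (\<Sum>i<n. a i * d i)"
  proof (cases n)
    case (Suc m)
    \<comment> \<open>Unit column sums make the total of \<open>d\<close> zero, which removes the
      boundary term of the Abel summation.\<close>
    have "(\<Sum>i<n. \<Sum>j<n. P i j * b j) = (\<Sum>j<n. \<Sum>i<n. P i j * b j)" by (rule sum.swap)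
    also have "\<dots> = (\<Sum>j<n. b j)" using col by (simp flip: sum_distrib_right)
    finally have "sum d {..<n} = 0" by (simp add: d_def sum_subtractf)
    then show ?thesis using abel_sum_ge[of m a d] a partial Suc by simp
  qed simp
  also have "\<dots> = (\<Sum>i<n. a i * b i) - (\<Sum>i<n. \<Sum>j<n. P i j * a i * b j)"
    unfolding sum_subtractf[symmetric]
    by (rule sum.cong) (auto simp: d_def algebra_simps sum_distrib_left)
  finally show ?thesis by simp
qed

lemma doubly_stochastic_rearrangement_antimono:
  fixes a b :: "nat \<Rightarrow> real" and P :: "nat \<Rightarrow> nat \<Rightarrow> real"
  assumes "\<And>i j. i < n \<Longrightarrow> j < n \<Longrightarrow> 0 \<le> P i j"
    and "\<And>i. i < n \<Longrightarrow> (\<Sum>j<n. P i j) = 1"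
    and "\<And>j. j < n \<Longrightarrow> (\<Sum>i<n. P i j) = 1"
    and "\<And>i j. i \<le> j \<Longrightarrow> j < n \<Longrightarrow> a i \<le> a j"
    and "\<And>i j. i \<le> j \<Longrightarrow> j < n \<Longrightarrow> b j \<le> b i"
  shows "(\<Sum>i<n. a i * b i) \<le> (\<Sum>i<n. \<Sum>j<n. P i j * a i * b j)"
  using doubly_stochastic_rearrangement[of n P a "\<lambda>j. - b j"] assms by (simp add: sum_negf)

subsection \<open>Traces, kernels and supports in eigenbases\<close>

abbreviation spectral_mat :: "nat \<Rightarrow> complex mat \<Rightarrow> (nat \<Rightarrow> real) \<Rightarrow> complex mat" where
  "spectral_mat n U d \<equiv> U * mat_diag n (\<lambda>i. complex_of_real (d i)) * mat_adjoint U"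

lemma spectral_mat_carrier: "U \<in> carrier_mat n n \<Longrightarrow> spectral_mat n U d \<in> carrier_mat n n"
  by (simp add: mult_carrier_mat[of _ n n _ n])

lemma unitary_conj_spectral_mat:
  assumes "unitary_mat n U" "unitary_mat n V"
  shows "U * spectral_mat n V d * mat_adjoint U = spectral_mat n (U * V) d"
  using assms
  by (simp add: unitary_mat_def mat_adjoint_mult[of _ n n _ n] assoc_mult_mat[of _ n n _ n _ n]
      mult_carrier_mat[of _ n n _ n])

lemma mat_trace_mult_commute:
  assumes "A \<in> carrier_mat n n" "B \<in> carrier_mat n n"
  shows "mat_trace (A * B) = mat_trace (B * A)"
proof -
  have "mat_trace (A * B) = (\<Sum>i<n. \<Sum>j<n. A $$ (i, j) * B $$ (j, i))"
    using assms by (auto simp: mat_trace_def scalar_prod_def lessThan_atLeast0 intro!: sum.cong)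
  also have "\<dots> = (\<Sum>j<n. \<Sum>i<n. A $$ (i, j) * B $$ (j, i))" by (rule sum.swap)
  also have "\<dots> = mat_trace (B * A)"
    using assms by (auto simp: mat_trace_def scalar_prod_def lessThan_atLeast0 mult.commute intro!: sum.cong)
  finally show ?thesis .
qed

lemma mat_trace_spectral_mat:
  assumes "unitary_mat n U"
  shows "mat_trace (spectral_mat n U d) = complex_of_real (\<Sum>i<n. d i)"
proof -
  from assms have U: "U \<in> carrier_mat n n" "mat_adjoint U \<in> carrier_mat n n" "mat_adjoint U * U = 1\<^sub>m n"
    by (auto simp: unitary_mat_def)
  let ?D = "mat_diag n (\<lambda>i. complex_of_real (d i))"
  have "mat_trace (spectral_mat n U d) = mat_trace (mat_adjoint U * (U * ?D))"
    using U by (intro mat_trace_mult_commute[of _ n]) (auto intro: mult_carrier_mat)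
  also have "mat_adjoint U * (U * ?D) = ?D"
    using U by (simp add: left_mult_one_mat[of _ n n] flip: assoc_mult_mat[of _ n n _ n _ n])
  finally show ?thesis by (simp add: mat_trace_def mat_diag_def)
qed

text \<open>By cyclicity the trace is that of W D(a) W* D(b) with W = V* U, whose diagonal entries
  produce the squared moduli of the overlaps between the two eigenbases.\<close>

lemma mat_trace_spectral_mat_mult:
  assumes "unitary_mat n U" "unitary_mat n V"
  shows "mat_trace (spectral_mat n U a * spectral_mat n V b) =
    complex_of_real (\<Sum>i<n. \<Sum>j<n. (cmod ((mat_adjoint V * U) $$ (j, i)))\<^sup>2 * a i * b j)"
proof -
  from assms have U: "U \<in> carrier_mat n n" "mat_adjoint U \<in> carrier_mat n n"
    and V: "V \<in> carrier_mat n n" "mat_adjoint V \<in> carrier_mat n n"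
    by (auto simp: unitary_mat_def)
  define W where "W = mat_adjoint V * U"
  let ?Da = "mat_diag n (\<lambda>i. complex_of_real (a i))" and ?Db = "mat_diag n (\<lambda>i. complex_of_real (b i))"
  have W: "W \<in> carrier_mat n n" using mult_carrier_mat[OF V(2) U(1)] by (simp add: W_def)
  then have aW: "mat_adjoint W \<in> carrier_mat n n" by simp
  note as = assoc_mult_mat[of _ n n _ n _ n] mult_carrier_mat[of _ n n _ n]
  have "mat_trace (spectral_mat n U a * spectral_mat n V b) =
      mat_trace ((spectral_mat n U a * V * ?Db) * mat_adjoint V)"
    using U V by (simp add: as)
  also have "\<dots> = mat_trace (mat_adjoint V * (spectral_mat n U a * V * ?Db))"
    using U V by (intro mat_trace_mult_commute[of _ n]) (simp_all add: as)
  also have "mat_adjoint V * (spectral_mat n U a * V * ?Db) = (W * ?Da) * mat_adjoint W * ?Db"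
    using U V by (simp add: W_def as mat_adjoint_mult[of _ n n _ n])
  also have "mat_trace \<dots> = (\<Sum>j<n. \<Sum>i<n. W $$ (j, i) * complex_of_real (a i) * cnj (W $$ (j, i)) * complex_of_real (b j))"
    using W aW
    by (auto simp: mat_trace_def mat_diag_mult_right[of _ n n] mult_carrier_mat[of _ n n _ n]
        scalar_prod_def lessThan_atLeast0 sum_distrib_right conjugate_complex_def intro!: sum.cong)
  also have "\<dots> = (\<Sum>j<n. \<Sum>i<n. complex_of_real ((cmod (W $$ (j, i)))\<^sup>2 * a i * b j))"
    by (intro sum.cong refl) (simp add: complex_norm_square ac_simps del: of_real_power)
  also have "\<dots> = complex_of_real (\<Sum>i<n. \<Sum>j<n. (cmod (W $$ (j, i)))\<^sup>2 * a i * b j)"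
    by (subst sum.swap) simp
  finally show ?thesis unfolding W_def .
qed

text \<open>Links the inner products that describe kernels and supports with the matrix entries that
  occur in the trace; the indices are swapped.\<close>

lemma cscalar_prod_col:
  assumes "U \<in> carrier_mat n n" "V \<in> carrier_mat n n" "i < n" "j < n"
  shows "col U i \<bullet>c col V j = (mat_adjoint V * U) $$ (j, i)"
  using assms by (auto simp: scalar_prod_def mult.commute intro!: sum.cong)

text \<open>These sums are diagonal entries of W* W and W W*. Hence the squared moduli of a unitary
  matrix form a doubly stochastic matrix.\<close>

lemma unitary_mat_sq_norm_sums:
  assumes "unitary_mat n W" "i < n"
  shows "(\<Sum>j<n. (cmod (W $$ (j, i)))\<^sup>2) = 1" "(\<Sum>j<n. (cmod (W $$ (i, j)))\<^sup>2) = 1"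
proof -
  from assms have W: "W \<in> carrier_mat n n" "mat_adjoint W * W = 1\<^sub>m n" "W * mat_adjoint W = 1\<^sub>m n"
    by (auto simp: unitary_mat_def)
  have "complex_of_real (\<Sum>j<n. (cmod (W $$ (j, i)))\<^sup>2) = (mat_adjoint W * W) $$ (i, i)"
    using W(1) assms(2)
    by (auto simp: scalar_prod_def lessThan_atLeast0 complex_norm_square conjugate_complex_def mult.commute
        simp del: of_real_power intro!: sum.cong)
  then show "(\<Sum>j<n. (cmod (W $$ (j, i)))\<^sup>2) = 1"
    using assms(2) unfolding W(2) by (simp flip: of_real_sum)
  have "complex_of_real (\<Sum>j<n. (cmod (W $$ (i, j)))\<^sup>2) = (W * mat_adjoint W) $$ (i, i)"
    using W(1) assms(2)
    by (auto simp: scalar_prod_def lessThan_atLeast0 complex_norm_square conjugate_complex_def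
        simp del: of_real_power intro!: sum.cong)
  then show "(\<Sum>j<n. (cmod (W $$ (i, j)))\<^sup>2) = 1"
    using assms(2) unfolding W(3) by (simp flip: of_real_sum)
qed

section \<open>Kernels and supports\<close>

lemma mult_mat_zero_vec:
  "A \<in> carrier_mat n m \<Longrightarrow> A *\<^sub>v 0\<^sub>v m = (0\<^sub>v n :: complex vec)"
  by (intro eq_vecI) (auto simp: scalar_prod_def)

text \<open>As \<open>U\<close> is injective, only D U* v has to vanish, and its coordinate
  \<open>i\<close> is \<open>d i\<close> times the overlap of \<open>v\<close> with column
  \<open>i\<close> of \<open>U\<close>.\<close>

lemma mat_kernel_spectral_mat_iff:
  assumes "unitary_mat n U" and v: "v \<in> carrier_vec n"
  shows "v \<in> mat_kernel (spectral_mat n U d) \<longleftrightarrow> (\<forall>i<n. d i = 0 \<or> v \<bullet>c col U i = 0)"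
proof -
  from assms have U: "U \<in> carrier_mat n n" "mat_adjoint U \<in> carrier_mat n n" "mat_adjoint U * U = 1\<^sub>m n"
    by (auto simp: unitary_mat_def)
  let ?D = "mat_diag n (\<lambda>i. complex_of_real (d i))"
  define w where "w = (?D * mat_adjoint U) *\<^sub>v v"
  have DU: "?D * mat_adjoint U \<in> carrier_mat n n" using U by (simp add: mult_carrier_mat[of _ n n _ n])
  have w: "w \<in> carrier_vec n" unfolding w_def using DU v by (rule mult_mat_vec_carrier)
  have eq: "spectral_mat n U d *\<^sub>v v = U *\<^sub>v w"
    using U v DU by (simp add: w_def assoc_mult_mat[of _ n n _ n _ n] assoc_mult_mat_vec[of _ n n _ n])
  have wi: "w $ i = complex_of_real (d i) * (v \<bullet>c col U i)" if "i < n" for i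
    using that U v
    by (simp add: w_def mat_diag_mult_left[of _ n n] scalar_prod_def sum_distrib_left ac_simps)
  have "v \<in> mat_kernel (spectral_mat n U d) \<longleftrightarrow> U *\<^sub>v w = 0\<^sub>v n"
    using mat_kernel[OF spectral_mat_carrier[OF U(1)], of d] v by (simp only: eq mem_Collect_eq simp_thms)
  also have "\<dots> \<longleftrightarrow> w = 0\<^sub>v n"
  proof
    have "mat_adjoint U *\<^sub>v 0\<^sub>v n = 0\<^sub>v n" using U(2) by (rule mult_mat_zero_vec)
    moreover assume "U *\<^sub>v w = 0\<^sub>v n"
    ultimately have "(mat_adjoint U * U) *\<^sub>v w = 0\<^sub>v n"
      using U(1,2) w by (simp add: assoc_mult_mat_vec[of _ n n _ n])
    then show "w = 0\<^sub>v n" unfolding U(3) using w by simp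
  qed (use U in \<open>simp add: mult_mat_zero_vec\<close>)
  also have "\<dots> \<longleftrightarrow> (\<forall>i<n. w $ i = 0)" using w by (auto intro: eq_vecI)
  finally show ?thesis using wi by auto
qed

text \<open>Column \<open>i\<close> of \<open>U\<close> lies in the first support because
  \<open>p i\<close> is nonzero, and column \<open>j\<close> of \<open>V\<close> in the second
  kernel because \<open>q j\<close> is zero. The inclusion makes them orthogonal.\<close>

lemma mat_supp_subset_imp_overlap_0:
  assumes U: "unitary_mat n U" and V: "unitary_mat n V"
    and sub: "mat_supp (spectral_mat n U p) \<subseteq> mat_supp (spectral_mat n V q)"
    and ij: "i < n" "j < n" and "p i \<noteq> 0" "q j = 0"
  shows "(mat_adjoint V * U) $$ (j, i) = 0"
proof -
  from U V have cU: "U \<in> carrier_mat n n" and cV: "V \<in> carrier_mat n n" "mat_adjoint V * V = 1\<^sub>m n"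
    by (auto simp: unitary_mat_def)
  have "col V j \<in> mat_kernel (spectral_mat n V q)"
    using cV ij \<open>q j = 0\<close> by (subst mat_kernel_spectral_mat_iff[OF V]) (auto simp: cscalar_prod_col)
  moreover have "col U i \<in> mat_supp (spectral_mat n U p)"
    unfolding mat_supp_def
  proof (safe)
    fix w assume w: "w \<in> mat_kernel (spectral_mat n U p)"
    then have cw: "w \<in> carrier_vec n" using cU by (auto simp: mat_kernel_def)
    then have "w \<bullet>c col U i = 0"
      using w ij \<open>p i \<noteq> 0\<close> mat_kernel_spectral_mat_iff[OF U cw] by auto
    then have "conjugate (w \<bullet>c col U i) = 0" by simp
    moreover have "conjugate (w \<bullet>c col U i) = col U i \<bullet>c w"
      using cw cU ij by (simp add: scalar_prod_def sum_conjugate conjugate_dist_mul mult.commute)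
    ultimately show "col U i \<bullet>c w = 0" by simp
  qed (use cU in auto)
  ultimately have "col U i \<bullet>c col V j = 0"
    using sub unfolding mat_supp_def by blast
  then show ?thesis unfolding cscalar_prod_col[OF cU cV(1) ij] .
qed

text \<open>In a common eigenbasis the kernels are included in the opposite direction, and
  orthogonal complements reverse inclusions.\<close>

lemma mat_supp_spectral_mat_mono:
  assumes U: "unitary_mat n U" and "\<And>i. i < n \<Longrightarrow> p i \<noteq> 0 \<Longrightarrow> q i \<noteq> 0"
  shows "mat_supp (spectral_mat n U p) \<subseteq> mat_supp (spectral_mat n U q)"
proof -
  from U have cU: "U \<in> carrier_mat n n" by (simp add: unitary_mat_def)
  have "mat_kernel (spectral_mat n U q) \<subseteq> mat_kernel (spectral_mat n U p)"
  proof
    fix v assume v: "v \<in> mat_kernel (spectral_mat n U q)"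
    then have cv: "v \<in> carrier_vec n" using cU by (auto simp: mat_kernel_def)
    show "v \<in> mat_kernel (spectral_mat n U p)"
      using v assms(2) unfolding mat_kernel_spectral_mat_iff[OF U cv] by blast
  qed
  then show ?thesis by (auto simp: mat_supp_def)
qed

text \<open>The quadratic form takes the value \<open>d i\<close> at the unit eigenvector
  \<open>col U i\<close>.\<close>

lemma eigenvalue_nonneg:
  assumes U: "unitary_mat n U" and "density_operator n (spectral_mat n U d)" "i < n"
  shows "0 \<le> d i"
proof -
  let ?D = "mat_diag n (\<lambda>i. complex_of_real (d i))"
  from U have cU: "U \<in> carrier_mat n n" "mat_adjoint U \<in> carrier_mat n n" "mat_adjoint U * U = 1\<^sub>m n"
    by (auto simp: unitary_mat_def)
  have S: "spectral_mat n U d \<in> carrier_mat n n" using cU(1) by (rule spectral_mat_carrier)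
  have "spectral_mat n U d *\<^sub>v col U i = col (spectral_mat n U d * U) i"
    using col_mult2[OF S cU(1) \<open>i < n\<close>] by simp
  also have "spectral_mat n U d * U = U * ?D"
    using cU by (simp add: assoc_mult_mat[of _ n n _ n _ n] mult_carrier_mat[of _ n n _ n] right_mult_one_mat[of _ n n])
  also have "col (U * ?D) i = complex_of_real (d i) \<cdot>\<^sub>v col U i"
    using cU \<open>i < n\<close> by (intro eq_vecI) (auto simp: mat_diag_mult_right[of _ n n])
  finally have "(spectral_mat n U d *\<^sub>v col U i) \<bullet>c col U i = complex_of_real (d i) * (col U i \<bullet>c col U i)"
    using cU by simp
  also have "\<dots> = complex_of_real (d i)" using cscalar_prod_col[of U n U i i] cU \<open>i < n\<close> by simp
  finally show ?thesis
    using assms(2) cU \<open>i < n\<close> unfolding density_operator_def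
    by (metis Re_complex_of_real col_carrier_vec carrier_matD(2) carrier_matD(1) col_dim)
qed

text \<open>Powers act on the eigenvalues by \<open>mat_powr_eqI\<close>, so the trace in the
  definition is the real overlap sum \<open>Q\<close>.\<close>

lemma petz_renyi_spectral_mat:
  fixes p q :: "nat \<Rightarrow> real" and \<alpha> :: real
  assumes U: "unitary_mat n U" and V: "unitary_mat n V"
  defines "Q \<equiv> (\<Sum>i<n. \<Sum>j<n. (cmod ((mat_adjoint V * U) $$ (j, i)))\<^sup>2 * (p i powr \<alpha>) * (q j powr (1 - \<alpha>)))"
  shows "petz_renyi \<alpha> (spectral_mat n U p) (spectral_mat n V q) =
    (if \<alpha> < 1 \<and> Q = 0 \<or>
        \<alpha> > 1 \<and> \<not> mat_supp (spectral_mat n U p) \<subseteq> mat_supp (spectral_mat n V q)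
     then \<infinity> else ereal (1 / (\<alpha> - 1) * ln Q))"
proof -
  have powr: "mat_powr (spectral_mat n X d) a = spectral_mat n X (\<lambda>i. d i powr a)" if "unitary_mat n X" for X d a
  proof -
    have "dim_row (spectral_mat n X d) = n" using that by (auto simp: unitary_mat_def)
    with that mat_powr_eqI[of "spectral_mat n X d" X d a] show ?thesis by simp
  qed
  show ?thesis
    unfolding petz_renyi_def powr[OF U] powr[OF V] mat_trace_spectral_mat_mult[OF U V]
    by (simp only: Q_def Let_def of_real_eq_0_iff Re_complex_of_real)
qed

subsection \<open>Minimisation over the unitary group\<close>

lemma petz_renyi_min_eqI:
  assumes "dim_row \<rho> = n" and U: "unitary_mat n U"
    and att: "petz_renyi \<alpha> (U * \<rho> * mat_adjoint U) \<sigma> = F"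
    and le: "\<And>V. unitary_mat n V \<Longrightarrow> F \<le> petz_renyi \<alpha> (V * \<rho> * mat_adjoint V) \<sigma>"
  shows "petz_renyi_min \<alpha> \<rho> \<sigma> = F"
  unfolding petz_renyi_min_def assms(1)
proof (rule antisym)
  show "(INF V\<in>{V. unitary_mat n V}. petz_renyi \<alpha> (V * \<rho> * mat_adjoint V) \<sigma>) \<le> F"
    unfolding att[symmetric] using U by (intro INF_lower) simp
qed (use le in \<open>auto intro: INF_greatest\<close>)

text \<open>The product of linear factors depends only on the multiset of roots. This gives
  diagonalisations with ascending eigenvalues.\<close>

lemma eigenvalue_vector_sort: "eigenvalue_vector A p \<Longrightarrow> eigenvalue_vector A (sort p)"
  unfolding eigenvalue_vector_def
  by (metis (no_types, lifting) mset_map mset_sort prod_mset_prod_list)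

lemma length_eigenvalue_vector:
  assumes "A \<in> carrier_mat n n" "eigenvalue_vector A p"
  shows "length p = n"
  using degree_monic_char_poly[OF assms(1)] assms(2)
    degree_linear_factors[of "\<lambda>x. - complex_of_real x" p]
  by (simp add: eigenvalue_vector_def)

theorem mainTheorem6:
  fixes \<alpha> :: real and n :: nat and \<rho> \<sigma> :: "complex mat" and p q :: "real list"
  assumes "\<alpha> \<in> {0<..<1} \<union> {1<..}"
    and "density_operator n \<rho>" and "density_operator n \<sigma>"
    and "eigenvalue_vector \<rho> p" and "eigenvalue_vector \<sigma> q"
  shows "(\<exists>U. unitary_mat n U \<and>
            petz_renyi \<alpha> (U * \<rho> * mat_adjoint U) \<sigma> = petz_renyi_min \<alpha> \<rho> \<sigma>) \<and>
         petz_renyi_min \<alpha> \<rho> \<sigma> =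
           ereal (1 / (\<alpha> - 1)) * ln_ereal (\<Sum>i<n. renyi_term \<alpha> (sort p ! i) (sort q ! i))"
proof -
  have car: "\<rho> \<in> carrier_mat n n" "\<sigma> \<in> carrier_mat n n"
    and herm: "mat_adjoint \<rho> = \<rho>" "mat_adjoint \<sigma> = \<sigma>"
    using assms(2,3) by (simp_all add: density_operator_def)
  define x y where "x i = sort p ! i" and "y i = sort q ! i" for i
  have len: "length p = n" "length q = n" using length_eigenvalue_vector car assms(4,5) by auto
  obtain R where R: "unitary_mat n R" and \<rho>: "\<rho> = spectral_mat n R x"
    using hermitian_spectral_decomposition[OF car(1) herm(1) eigenvalue_vector_sort[OF assms(4)]]
    unfolding x_def by blast
  obtain V where V: "unitary_mat n V" and \<sigma>: "\<sigma> = spectral_mat n V y"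
    using hermitian_spectral_decomposition[OF car(2) herm(2) eigenvalue_vector_sort[OF assms(5)]]
    unfolding y_def by blast
  have x0: "0 \<le> x i" if "i < n" for i using eigenvalue_nonneg[OF R] assms(2) \<rho> that by blast
  have y0: "0 \<le> y i" if "i < n" for i using eigenvalue_nonneg[OF V] assms(3) \<sigma> that by blast
  have xm: "x i \<le> x j" and ym: "y i \<le> y j" if "i \<le> j" "j < n" for i j
    using that len by (simp_all add: x_def y_def sorted_nth_mono)
  define w where "w = (\<lambda>U i j. (cmod ((mat_adjoint V * (U * R)) $$ (j, i)))\<^sup>2)"
  have w: "0 \<le> w U i j" for U i j by (simp add: w_def)
  have wrow: "(\<Sum>j<n. w U i j) = 1" and wcol: "(\<Sum>j<n. w U j i) = 1" if "unitary_mat n U" "i < n" for U i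
    using unitary_mat_sq_norm_sums[OF unitary_mat_mult[OF unitary_mat_adjoint[OF V] unitary_mat_mult[OF that(1) R]] that(2)]
    unfolding w_def by auto
  define a b where "a i = x i powr \<alpha>" and "b i = y i powr (1 - \<alpha>)" for i
  have a0: "0 \<le> a i" and b0: "0 \<le> b i" for i by (simp_all add: a_def b_def)
  have am: "a i \<le> a j" if "i \<le> j" "j < n" for i j
    using assms(1) x0 xm that unfolding a_def by (intro powr_mono2) auto
  define S where "S = (\<Sum>i<n. a i * b i)"
  define Q where "Q U = (\<Sum>i<n. \<Sum>j<n. w U i j * a i * b j)" for U
  define incl where "incl U \<longleftrightarrow> mat_supp (spectral_mat n (U * R) x) \<subseteq> mat_supp (spectral_mat n V y)" for U
  define F where "F = ereal (1 / (\<alpha> - 1)) * ln_ereal (\<Sum>i<n. renyi_term \<alpha> (x i) (y i))"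
  have petz: "petz_renyi \<alpha> (U * \<rho> * mat_adjoint U) \<sigma> =
      (if \<alpha> < 1 \<and> Q U = 0 \<or> \<alpha> > 1 \<and> \<not> incl U then \<infinity> else ereal (1 / (\<alpha> - 1) * ln (Q U)))"
    if "unitary_mat n U" for U
    unfolding \<rho> \<sigma> unitary_conj_spectral_mat[OF that R]
      petz_renyi_spectral_mat[OF unitary_mat_mult[OF that R] V] incl_def Q_def w_def a_def b_def ..
  \<comment> \<open>\<open>U\<^sub>0\<close> maps the sorted eigenbasis of \<rho> to that of
    \<sigma>, so its weights form the identity matrix.\<close>
  define U\<^sub>0 where "U\<^sub>0 = V * mat_adjoint R"
  have U\<^sub>0: "unitary_mat n U\<^sub>0"
    unfolding U\<^sub>0_def by (intro unitary_mat_mult V unitary_mat_adjoint R)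
  have U\<^sub>0R: "U\<^sub>0 * R = V"
    using R V by (simp add: U\<^sub>0_def unitary_mat_def assoc_mult_mat[of _ n n _ n _ n] right_mult_one_mat[of _ n n])
  have "w U\<^sub>0 i j = (if i = j then 1 else 0)" if "i < n" "j < n" for i j
    using V that unfolding w_def U\<^sub>0R by (auto simp: unitary_mat_def)
  then have "Q U\<^sub>0 = (\<Sum>i<n. \<Sum>j<n. if i = j then a i * b j else 0)"
    unfolding Q_def by (intro sum.cong refl) auto
  then have Q\<^sub>0: "Q U\<^sub>0 = S" by (simp add: S_def)
  have Q0: "0 \<le> Q U" for U unfolding Q_def by (intro sum_nonneg mult_nonneg_nonneg w a0 b0)
  have S0: "0 \<le> S" using Q0 Q\<^sub>0 by metis
  have eq: "petz_renyi \<alpha> (U\<^sub>0 * \<rho> * mat_adjoint U\<^sub>0) \<sigma> = F"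
    and le: "F \<le> petz_renyi \<alpha> (U * \<rho> * mat_adjoint U) \<sigma>" if U: "unitary_mat n U" for U
  proof -
    \<comment> \<open>For \<alpha> > 1 the split is on whether some term of the claimed sum is
      infinite.\<close>
    consider "\<alpha> < 1" | "\<alpha> > 1" "\<forall>i<n. y i = 0 \<longrightarrow> x i = 0" | i where "\<alpha> > 1" "i < n" "y i = 0" "x i \<noteq> 0"
      using assms(1) by force
    then have "petz_renyi \<alpha> (U\<^sub>0 * \<rho> * mat_adjoint U\<^sub>0) \<sigma> = F \<and> F \<le> petz_renyi \<alpha> (U * \<rho> * mat_adjoint U) \<sigma>"
    proof cases
      case 1
      \<comment> \<open>At \<open>S = 0\<close> the value \<open>- \<infinity>\<close> of
        \<open>ln_ereal\<close> meets a negative factor, in agreement with the convention for a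
        vanishing trace.\<close>
      have F: "F = (if S = 0 then \<infinity> else ereal (1 / (\<alpha> - 1) * ln S))"
        using 1 S0 by (simp add: F_def renyi_term_def ln_ereal_def S_def a_def b_def)
      have bm: "b i \<le> b j" if "i \<le> j" "j < n" for i j
        using 1 y0 ym that unfolding b_def by (intro powr_mono2) auto
      have QS: "Q U \<le> S" unfolding Q_def S_def
        using w wrow[OF U] wcol[OF U] am bm by (intro doubly_stochastic_rearrangement)
      have "F \<le> petz_renyi \<alpha> (U * \<rho> * mat_adjoint U) \<sigma>"
      proof (cases "Q U = 0")
        case False
        \<comment> \<open>The factor 1 / (\<alpha> - 1) is negative, so the upper bound on
          \<open>Q U\<close> becomes a lower bound on the entropy.\<close>
        then have "ln (Q U) \<le> ln S" "S \<noteq> 0" using Q0[of U] QS by auto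
        then show ?thesis using 1 petz[OF U] False by (simp add: F divide_right_mono_neg)
      qed (use 1 petz[OF U] in simp)
      moreover have "petz_renyi \<alpha> (U\<^sub>0 * \<rho> * mat_adjoint U\<^sub>0) \<sigma> = F"
        using 1 petz[OF U\<^sub>0] by (simp add: F Q\<^sub>0)
      ultimately show ?thesis by blast
    next
      case 2
      \<comment> \<open>Where \<open>y i = 0\<close>, also \<open>x i = 0\<close>, and the
        convention 0 agrees with the value of \<open>a i * b i\<close>.\<close>
      have "(\<Sum>i<n. renyi_term \<alpha> (x i) (y i)) = (\<Sum>i<n. ereal (a i * b i))"
        using 2 by (intro sum.cong) (auto simp: renyi_term_def a_def b_def)
      then have sumS: "(\<Sum>i<n. renyi_term \<alpha> (x i) (y i)) = ereal S" by (simp add: S_def)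
      \<comment> \<open>Unit trace provides a nonzero eigenvalue of \<rho>; it makes
        \<open>S\<close> positive, so that \<open>ln_ereal\<close> is the ordinary logarithm
        there.\<close>
      have "(\<Sum>i<n. x i) = 1"
        using assms(2) mat_trace_spectral_mat[OF R, of x] \<rho>
        by (simp add: density_operator_def flip: of_real_sum)
      then obtain k where k: "k < n" "x k \<noteq> 0"
        by (metis lessThan_iff sum.neutral zero_neq_one)
      then have "0 < a k * b k" using 2 x0 y0 by (auto simp: a_def b_def)
      also have "\<dots> \<le> S" unfolding S_def using k a0 b0 by (intro member_le_sum) auto
      finally have Spos: "0 < S" .
      have F: "F = ereal (1 / (\<alpha> - 1) * ln S)" unfolding F_def sumS using Spos by (simp add: ln_ereal_def)
      have "incl U\<^sub>0" unfolding incl_def U\<^sub>0R using 2 by (intro mat_supp_spectral_mat_mono V) auto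
      then have "petz_renyi \<alpha> (U\<^sub>0 * \<rho> * mat_adjoint U\<^sub>0) \<sigma> = F" using 2 petz[OF U\<^sub>0] by (simp add: F Q\<^sub>0)
      moreover have "F \<le> petz_renyi \<alpha> (U * \<rho> * mat_adjoint U) \<sigma>"
      proof (cases "incl U")
        case True
        have w0: "w U i j = 0" if "i < n" "j < n" "x i \<noteq> 0" "y j = 0" for i j
          using mat_supp_subset_imp_overlap_0[OF unitary_mat_mult[OF U R] V _ that(1,2), of x y] True that
          by (simp add: incl_def w_def)
        \<comment> \<open>As \<open>0 powr (1 - \<alpha>) = 0\<close>, \<open>b\<close> is not antimonotone; \<open>c\<close> is, and the inclusion of
          supports makes the weights vanish wherever the two differ and \<open>a\<close> is nonzero.\<close>
        define c where "c j = (if y j = 0 then \<Sum>i<n. b i else b j)" for j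
        have cm: "c j \<le> c i" if "i \<le> j" "j < n" for i j
        proof (cases "y i = 0")
          case True
          \<comment> \<open>The sum of all \<open>b i\<close> stands in for infinity at zero
            eigenvalues: it is finite and dominates every \<open>b j\<close>.\<close>
          have "b j \<le> (\<Sum>i<n. b i)" using that b0 by (intro member_le_sum) auto
          then show ?thesis using True by (simp add: c_def)
        next
          case False
          then have "0 < y i" "y i \<le> y j" using y0[of i] ym[of i j] that by auto
          then show ?thesis using 2 unfolding c_def b_def by (auto intro!: powr_mono2')
        qed
        \<comment> \<open>\<open>b\<close> and \<open>c\<close> can differ only where
          \<open>y i = 0\<close>; there \<open>x i = 0\<close> and hence
          \<open>a i = 0\<close>.\<close>
        have "S = (\<Sum>i<n. a i * c i)"
          unfolding S_def using 2 by (intro sum.cong) (auto simp: c_def a_def)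
        also have "\<dots> \<le> (\<Sum>i<n. \<Sum>j<n. w U i j * a i * c j)"
          using w wrow[OF U] wcol[OF U] am cm by (intro doubly_stochastic_rearrangement_antimono)
        also have "\<dots> = Q U"
          unfolding Q_def using w0 by (intro sum.cong refl) (fastforce simp: c_def a_def)
        finally have "ln S \<le> ln (Q U)" using Spos by simp
        then show ?thesis using 2 True petz[OF U] by (simp add: F divide_right_mono)
      qed (use 2 petz[OF U] in simp)
      ultimately show ?thesis by blast
    next
      case 3
      have "\<infinity> = renyi_term \<alpha> (x i) (y i)" using 3 by (simp add: renyi_term_def)
      also have "\<dots> \<le> (\<Sum>i<n. renyi_term \<alpha> (x i) (y i))"
        using 3 sum_mono2[of "{..<n}" "{i}" "\<lambda>i. renyi_term \<alpha> (x i) (y i)"]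
        by (simp add: renyi_term_def)
      finally have F: "F = \<infinity>" using 3 by (simp add: F_def ln_ereal_def)
      \<comment> \<open>With \<open>F\<close> infinite, every unitary must give infinity, so the
        supports must fail to be included for all of them.\<close>
      have "\<not> incl U" if U: "unitary_mat n U" for U
      proof
        assume "incl U"
        then have w0: "w U i j = 0" if "i < n" "j < n" "x i \<noteq> 0" "y j = 0" for i j
          using mat_supp_subset_imp_overlap_0[OF unitary_mat_mult[OF U R] V _ that(1,2), of x y] that
          by (simp add: incl_def w_def)
        \<comment> \<open>Rearrangement for the indicators of \<open>x > 0\<close> and \<open>y = 0\<close>: the inclusion of supports makes
          the weighted double sum vanish, although the diagonal sum has a term equal to \<open>1\<close>.\<close>
        define f g where "f i = (if x i = 0 then 0 else 1 :: real)" and "g i = (if y i = 0 then 1 else 0 :: real)" for i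
        have "f i * g i \<le> (\<Sum>i<n. f i * g i)"
          using 3 by (intro member_le_sum) (auto simp: f_def g_def)
        also have "\<dots> \<le> (\<Sum>i<n. \<Sum>j<n. w U i j * f i * g j)"
        proof (intro doubly_stochastic_rearrangement_antimono w wrow[OF U] wcol[OF U])
          fix i j assume "i \<le> j" "j < n"
          then show "f i \<le> f j" "g j \<le> g i"
            using x0[of i] xm[of i j] y0[of i] ym[of i j] by (auto simp: f_def g_def)
        qed
        also have "\<dots> = 0" by (intro sum.neutral ballI) (auto simp: f_def g_def w0)
        finally show False using 3 by (simp add: f_def g_def)
      qed
      then show ?thesis using 3 U U\<^sub>0 petz by (simp add: F)
    qed
    then show "petz_renyi \<alpha> (U\<^sub>0 * \<rho> * mat_adjoint U\<^sub>0) \<sigma> = F"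
      and "F \<le> petz_renyi \<alpha> (U * \<rho> * mat_adjoint U) \<sigma>" by blast+
  qed
  have "petz_renyi_min \<alpha> \<rho> \<sigma> = F"
    using car eq[OF U\<^sub>0] le U\<^sub>0 by (intro petz_renyi_min_eqI[of _ n U\<^sub>0]) auto
  then show ?thesis using U\<^sub>0 eq[OF U\<^sub>0] unfolding F_def x_def y_def by metis
qed

end
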